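(* Let $p>2$ be a prime, let $k$ be an algebraically closed field of characteristic $p$, let $n\ge 1$, and let $n_1,\dots,n_n\ge 0$ be integers. Let $A_n=k\langle x_1,\dots,x_n\rangle$ be the free associative unital $k$-algebra on $n$ generators, let $f_1,\dots,f_m\in A_n$ be noncommutative polynomials in $x_1^{p^{n_1}},\dots,x_n^{p^{n_n}}$ (i.e. elements of the unital $k$-subalgebra of $A_n$ generated by these powers), and let $A=A_n/(f_1,\dots,f_m)$ be the quotient by the two-sided ideal they generate. Let $i\ge 1$ and suppose that $N_i(A)$ is finite dimensional over $k$. Then $\dim_k N_i(A)$ is divisible by $p^{n_1+\cdots+n_n}$.
   Context: For an associative algebra $A$, define $L_1(A)=A$ and $L_{i+1}(A)=[A,L_i(A)]$ (the linear span of all commutators $[a,l]=al-la$ with $a\in A$, $l\in L_i(A)$), $M_i(A)=A\,L_i(A)\,A$ (the two-sided ideal generated by $L_i(A)$), and $N_i(A)=M_i(A)/M_{i+1}(A)$. *)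

theory Defs
  imports
    "HOL-Library.Poly_Mapping"
    "HOL-Computational_Algebra.Polynomial"
    "HOL-Computational_Algebra.Primes"
    "HOL-Algebra.QuotRing"
    "Jordan_Normal_Form.VS_Connect"
begin

text \<open>
  Associative unital algebras over a field of type \<open>'k\<close> are records of type
  \<open>('k, 'a) module\<close>; the scalars are \<open>class_ring\<close>, the record form of the whole type \<open>'k\<close>.
\<close>

section \<open>The free algebra\<close>

datatype 'n free_monoid = Word "'n list"

instantiation free_monoid :: (type) monoid_add
begin

definition zero_free_monoid :: "'n free_monoid" where
  "zero_free_monoid = Word []"

fun plus_free_monoid :: "'n free_monoid \<Rightarrow> 'n free_monoid \<Rightarrow> 'n free_monoid" where
  "plus_free_monoid (Word u) (Word v) = Word (u @ v)"

instance
proof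
  fix a b c :: "'n free_monoid"
  show "a + b + c = a + (b + c)" by (cases a; cases b; cases c) simp
  show "0 + a = a" "a + 0 = a" by (cases a; simp add: zero_free_monoid_def)+
qed

end

text \<open>
  The monoid algebra of the free monoid; \<open>Poly_Mapping\<close> supplies the convolution product.
\<close>

type_synonym ('n, 'k) ncpoly = "'n free_monoid \<Rightarrow>\<^sub>0 'k"

definition ncvar :: "'n \<Rightarrow> ('n, 'k::field) ncpoly" where
  "ncvar j = Poly_Mapping.single (Word [j]) 1"

definition free_algebra :: "('k::field, ('n, 'k) ncpoly) module" where
  "free_algebra = \<lparr>carrier = UNIV, mult = (*), one = 1, zero = 0, add = (+),
     smult = (\<lambda>c f. Poly_Mapping.map ((*) c) f)\<rparr>"

section \<open>Subalgebras and quotients\<close>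

inductive_set subalgebra_generated :: "('k::field, 'a) module \<Rightarrow> 'a set \<Rightarrow> 'a set"
  for A :: "('k, 'a) module" and S :: "'a set" where
  generator: "s \<in> S \<Longrightarrow> s \<in> subalgebra_generated A S"
| one: "\<one>\<^bsub>A\<^esub> \<in> subalgebra_generated A S"
| add: "x \<in> subalgebra_generated A S \<Longrightarrow> y \<in> subalgebra_generated A S
    \<Longrightarrow> x \<oplus>\<^bsub>A\<^esub> y \<in> subalgebra_generated A S"
| mult: "x \<in> subalgebra_generated A S \<Longrightarrow> y \<in> subalgebra_generated A S
    \<Longrightarrow> x \<otimes>\<^bsub>A\<^esub> y \<in> subalgebra_generated A S"
| smult: "x \<in> subalgebra_generated A S \<Longrightarrow> c \<odot>\<^bsub>A\<^esub> x \<in> subalgebra_generated A S"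

text \<open>
  The operations on cosets are those of \<open>FactRing\<close>, together with \<open>c (I + x) = I + c x\<close>.  The
  construction also serves for the quotient of a submodule by a smaller one, in which case only
  the additive structure and the scalar multiplication of the result are meaningful.
\<close>

definition quotient_algebra :: "('k::field, 'a) module \<Rightarrow> 'a set \<Rightarrow> ('k, 'a set) module" where
  "quotient_algebra A I = ring.extend (A Quot I)
     (module.fields (\<lambda>c X. \<Union>x\<in>X. I +>\<^bsub>A\<^esub> (c \<odot>\<^bsub>A\<^esub> x)))"

section \<open>The lower central series and its ideals\<close>

text \<open>The series is indexed from 1; the value at 0 is junk.\<close>

fun lower_central :: "('k::field, 'a) module \<Rightarrow> nat \<Rightarrow> 'a set" where
  "lower_central A 0 = carrier A"
| "lower_central A (Suc 0) = carrier A"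
| "lower_central A (Suc (Suc i)) = LinearCombinations.module.span class_ring A
     {a \<otimes>\<^bsub>A\<^esub> l \<ominus>\<^bsub>A\<^esub> l \<otimes>\<^bsub>A\<^esub> a | a l. a \<in> carrier A \<and> l \<in> lower_central A (Suc i)}"

definition lower_central_ideal :: "('k::field, 'a) module \<Rightarrow> nat \<Rightarrow> 'a set" where
  "lower_central_ideal A i = Idl\<^bsub>A\<^esub> (lower_central A i)"

definition lower_central_quotient :: "('k::field, 'a) module \<Rightarrow> nat \<Rightarrow> ('k, 'a set) module" where
  "lower_central_quotient A i =
     quotient_algebra (A\<lparr>carrier := lower_central_ideal A i\<rparr>) (lower_central_ideal A (Suc i))"

section \<open>The quotients are vector spaces\<close>

text \<open>
  Outside the locale \<open>vectorspace\<close>, \<open>vectorspace.dim\<close> has its intended meaning only for records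
  satisfying the locale; this section shows that the successive quotients do.
\<close>

definition assoc_algebra :: "('k::field, 'a) module \<Rightarrow> bool" where
  "assoc_algebra A \<longleftrightarrow> Module.module class_ring A \<and> ring A \<and>
    (\<forall>c. \<forall>x\<in>carrier A. \<forall>y\<in>carrier A.
       (c \<odot>\<^bsub>A\<^esub> x) \<otimes>\<^bsub>A\<^esub> y = c \<odot>\<^bsub>A\<^esub> (x \<otimes>\<^bsub>A\<^esub> y) \<and> x \<otimes>\<^bsub>A\<^esub> (c \<odot>\<^bsub>A\<^esub> y) = c \<odot>\<^bsub>A\<^esub> (x \<otimes>\<^bsub>A\<^esub> y))"

lemma class_ring_cring: "cring (class_ring :: 'k::field ring)"
  by (rule class_cring.cring_axioms)

lemma map_eq_single_mult: "Poly_Mapping.map ((*) c) f = Poly_Mapping.single 0 c * (f :: ('n,'k::field) ncpoly)"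
proof (rule poly_mapping_eqI)
  fix k
  show "Poly_Mapping.lookup (Poly_Mapping.map ((*) c) f) k = Poly_Mapping.lookup (Poly_Mapping.single 0 c * f) k"
    by (simp add: Poly_Mapping.map.rep_eq lookup_mult lookup_single when_mult Sum_any_when_equal Sum_any_when_equal')
       (simp add: when_def)
qed

lemma map_eq_mult_single: "Poly_Mapping.map ((*) c) f = f * Poly_Mapping.single 0 c" for f :: "('n,'k::field) ncpoly"
proof (rule poly_mapping_eqI)
  fix k
  have "((c when q = 0) when k = l + q) = ((c when l = k) when q = 0)" for l q :: "'n free_monoid"
    by (auto simp: when_def)
  then have *: "(\<Sum>q. (c when q = 0) when k = l + q) = (c when l = k)" for l :: "'n free_monoid"
    by (simp only: Sum_any_when_equal)
  show "Poly_Mapping.lookup (Poly_Mapping.map ((*) c) f) k = Poly_Mapping.lookup (f * Poly_Mapping.single 0 c) k"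
    by (simp add: Poly_Mapping.map.rep_eq lookup_mult lookup_single eq_commute[of 0] *)
      (simp add: mult_when Sum_any_when_equal, simp add: mult.commute when_def)
qed

lemma free_algebra_simps [simp]: "carrier free_algebra = UNIV" "mult free_algebra = (*)" "one free_algebra = 1"
  "zero free_algebra = 0" "add free_algebra = (+)"
  "Module.smult free_algebra c f = Poly_Mapping.single 0 c * f"
  by (simp_all add: free_algebra_def map_eq_single_mult)

lemma assoc_algebra_free_algebra: "assoc_algebra (free_algebra :: ('k::field, ('n,'k) ncpoly) module)"
proof -
  let ?F = "free_algebra :: ('k::field, ('n,'k) ncpoly) module"
  have ab: "abelian_group ?F"
    by (rule abelian_groupI) (auto simp: algebra_simps intro: exI[of _ "- _"] add.left_inverse)
  have mon: "Group.monoid ?F" by (rule monoidI) (auto simp: mult.assoc)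
  have r: "ring ?F" by (rule ringI[OF ab mon]) (auto simp: algebra_simps)
  have m: "Module.module class_ring ?F"
    by (rule moduleI[OF class_ring_cring ab]) (simp_all add: distrib_left distrib_right single_add mult_single mult.assoc [symmetric])
  show ?thesis unfolding assoc_algebra_def
  proof (intro conjI r m allI ballI)
    fix c :: 'k and x y :: "('n,'k) ncpoly"
    have "x * Poly_Mapping.single 0 c = Poly_Mapping.single 0 c * x"
      using map_eq_single_mult[of c x] map_eq_mult_single[of c x] by simp
    then show "x \<otimes>\<^bsub>?F\<^esub> (c \<odot>\<^bsub>?F\<^esub> y) = c \<odot>\<^bsub>?F\<^esub> (x \<otimes>\<^bsub>?F\<^esub> y)"
      by (simp flip: mult.assoc)
  qed (simp add: mult.assoc)
qed

lemma ideal_smult: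
  assumes "assoc_algebra A" "ideal I A" "x \<in> I"
  shows "c \<odot>\<^bsub>A\<^esub> x \<in> I"
proof -
  interpret ideal I A by fact
  interpret M: Module.module class_ring A using assms by (simp add: assoc_algebra_def)
  have x: "x \<in> carrier A" using assms a_Hcarr by blast
  then have "c \<odot>\<^bsub>A\<^esub> x = (c \<odot>\<^bsub>A\<^esub> \<one>\<^bsub>A\<^esub>) \<otimes>\<^bsub>A\<^esub> x"
    using assms(1) by (simp add: assoc_algebra_def)
  also have "\<dots> \<in> I" using assms M.smult_closed[of c "\<one>\<^bsub>A\<^esub>"] by (auto intro: I_l_closed)
  finally show ?thesis .
qed

lemma quotient_algebra_simps: "carrier (quotient_algebra A I) = a_rcosets\<^bsub>A\<^esub> I"
  "mult (quotient_algebra A I) = rcoset_mult A I" "one (quotient_algebra A I) = I +>\<^bsub>A\<^esub> \<one>\<^bsub>A\<^esub>"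
  "zero (quotient_algebra A I) = I" "add (quotient_algebra A I) = set_add A"
  "Module.smult (quotient_algebra A I) c X = (\<Union>x\<in>X. I +>\<^bsub>A\<^esub> (c \<odot>\<^bsub>A\<^esub> x))"
  by (simp_all add: quotient_algebra_def FactRing_def ring.extend_def module.fields_def)

lemma module_quotient_algebra:
  fixes B :: "('k::field,'a) module"
  assumes M: "Module.module class_ring B" and I: "additive_subgroup I B"
    and sm: "\<And>c x. x \<in> I \<Longrightarrow> c \<odot>\<^bsub>B\<^esub> x \<in> I"
  shows "Module.module class_ring (quotient_algebra B I)"
    and "\<And>c x. x \<in> carrier B \<Longrightarrow> c \<odot>\<^bsub>quotient_algebra B I\<^esub> (I +>\<^bsub>B\<^esub> x) = I +>\<^bsub>B\<^esub> (c \<odot>\<^bsub>B\<^esub> x)"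
proof -
  interpret M: Module.module class_ring B by fact
  interpret I: additive_subgroup I B by fact
  interpret I: abelian_subgroup I B 
    by (rule abelian_subgroupI3) (fact I, unfold_locales)
  let ?Q = "quotient_algebra B I"
  have cos: "I +>\<^bsub>B\<^esub> x = I +>\<^bsub>B\<^esub> y" if "x \<in> I +>\<^bsub>B\<^esub> y" "y \<in> carrier B" for x y
    using that I.a_repr_independence' by blast
  show S: "c \<odot>\<^bsub>?Q\<^esub> (I +>\<^bsub>B\<^esub> x) = I +>\<^bsub>B\<^esub> (c \<odot>\<^bsub>B\<^esub> x)" if x: "x \<in> carrier B" for c x
  proof -
    have "I +>\<^bsub>B\<^esub> (c \<odot>\<^bsub>B\<^esub> y) = I +>\<^bsub>B\<^esub> (c \<odot>\<^bsub>B\<^esub> x)" if y: "y \<in> I +>\<^bsub>B\<^esub> x" for y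
    proof -
      obtain h where h: "h \<in> I" "y = h \<oplus>\<^bsub>B\<^esub> x" using y by (auto simp: a_r_coset_def')
      have "c \<odot>\<^bsub>B\<^esub> y = c \<odot>\<^bsub>B\<^esub> h \<oplus>\<^bsub>B\<^esub> c \<odot>\<^bsub>B\<^esub> x"
        using h x I.a_Hcarr by (simp add: M.smult_r_distr)
      then show ?thesis using sm[OF h(1)] x by (intro cos) (auto simp: a_r_coset_def')
    qed
    moreover have "x \<in> I +>\<^bsub>B\<^esub> x" using x I.a_rcos_self by blast
    ultimately show ?thesis unfolding quotient_algebra_simps by blast
  qed
  have Aadd: "(I +>\<^bsub>B\<^esub> x) \<oplus>\<^bsub>?Q\<^esub> (I +>\<^bsub>B\<^esub> y) = I +>\<^bsub>B\<^esub> (x \<oplus>\<^bsub>B\<^esub> y)"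
    if "x \<in> carrier B" "y \<in> carrier B" for x y
    using that by (simp add: quotient_algebra_simps I.a_rcos_sum)
  have car: "carrier ?Q = (\<lambda>x. I +>\<^bsub>B\<^esub> x) ` carrier B"
    by (auto simp: quotient_algebra_simps A_RCOSETS_def' )
  have Z: "\<zero>\<^bsub>?Q\<^esub> = I +>\<^bsub>B\<^esub> \<zero>\<^bsub>B\<^esub>" using M.a_coset_add_zero[OF I.a_subset] by (simp add: quotient_algebra_simps)
  have ab: "abelian_group ?Q"
  proof (rule abelian_groupI)
    fix x assume "x \<in> carrier ?Q"
    then obtain a where a: "a \<in> carrier B" "x = I +>\<^bsub>B\<^esub> a" by (auto simp: car)
    then have "(I +>\<^bsub>B\<^esub> (\<ominus>\<^bsub>B\<^esub> a)) \<oplus>\<^bsub>?Q\<^esub> x = \<zero>\<^bsub>?Q\<^esub>"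
      by (simp add: a Aadd Z M.l_neg)
    then show "\<exists>y\<in>carrier ?Q. y \<oplus>\<^bsub>?Q\<^esub> x = \<zero>\<^bsub>?Q\<^esub>" using a by (auto simp: car)
  qed (auto simp: car Aadd Z M.a_ac)
  show "Module.module class_ring ?Q"
    by (rule moduleI[OF class_ring_cring ab])
      (auto simp: car Aadd S M.smult_l_distr M.smult_r_distr M.smult_assoc1
        M.smult_l_distr[simplified] M.smult_assoc1[simplified] M.smult_one[simplified] M.smult_closed[simplified])
qed

lemma assoc_algebra_quotient:
  assumes A: "assoc_algebra A" and I: "ideal I A"
  shows "assoc_algebra (quotient_algebra A I)"
proof -
  interpret ideal I A by fact
  interpret M: Module.module class_ring A using assms by (simp add: assoc_algebra_def)
  note Q = module_quotient_algebra[OF M.module_axioms additive_subgroup_axioms ideal_smult[OF A I]]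
  let ?Q = "quotient_algebra A I"
  interpret QM: Module.module class_ring ?Q by (rule Q(1)) 
  interpret R: ring "A Quot I" by (rule quotient_is_ring)
  have car: "carrier ?Q = (\<lambda>x. I +>\<^bsub>A\<^esub> x) ` carrier A"
    by (auto simp: quotient_algebra_simps A_RCOSETS_def' )
  have mm: "(I +>\<^bsub>A\<^esub> x) \<otimes>\<^bsub>?Q\<^esub> (I +>\<^bsub>A\<^esub> y) = I +>\<^bsub>A\<^esub> (x \<otimes>\<^bsub>A\<^esub> y)"
    if "x \<in> carrier A" "y \<in> carrier A" for x y
    using that by (simp add: quotient_algebra_simps rcoset_mult_add)
  have "ring ?Q"
  proof (rule ringI)
    show "abelian_group ?Q" by unfold_locales
    have sel: "carrier (A Quot I) = carrier ?Q" "mult (A Quot I) = mult ?Q" "one (A Quot I) = one ?Q"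
       "add (A Quot I) = add ?Q" by (simp_all add: quotient_algebra_simps FactRing_def)
    show "Group.monoid ?Q" using R.monoid_axioms unfolding Group.monoid_def sel .
    show "(x \<oplus>\<^bsub>?Q\<^esub> y) \<otimes>\<^bsub>?Q\<^esub> z = x \<otimes>\<^bsub>?Q\<^esub> z \<oplus>\<^bsub>?Q\<^esub> y \<otimes>\<^bsub>?Q\<^esub> z"
      "z \<otimes>\<^bsub>?Q\<^esub> (x \<oplus>\<^bsub>?Q\<^esub> y) = z \<otimes>\<^bsub>?Q\<^esub> x \<oplus>\<^bsub>?Q\<^esub> z \<otimes>\<^bsub>?Q\<^esub> y"
      if "x \<in> carrier ?Q" "y \<in> carrier ?Q" "z \<in> carrier ?Q" for x y z
      by (rule R.l_distr[unfolded sel, OF that], rule R.r_distr[unfolded sel, OF that])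
  qed
  moreover have "(c \<odot>\<^bsub>?Q\<^esub> X) \<otimes>\<^bsub>?Q\<^esub> Y = c \<odot>\<^bsub>?Q\<^esub> (X \<otimes>\<^bsub>?Q\<^esub> Y) \<and> X \<otimes>\<^bsub>?Q\<^esub> (c \<odot>\<^bsub>?Q\<^esub> Y) = c \<odot>\<^bsub>?Q\<^esub> (X \<otimes>\<^bsub>?Q\<^esub> Y)"
    if XY: "X \<in> carrier ?Q" "Y \<in> carrier ?Q" for c X Y
  proof -
    obtain x y where xy: "x \<in> carrier A" "y \<in> carrier A" "X = I +>\<^bsub>A\<^esub> x" "Y = I +>\<^bsub>A\<^esub> y"
      using XY by (auto simp: car)
    then have "c \<odot>\<^bsub>A\<^esub> x \<in> carrier A" "c \<odot>\<^bsub>A\<^esub> y \<in> carrier A" "x \<otimes>\<^bsub>A\<^esub> y \<in> carrier A"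
      using M.smult_closed[of c] by simp_all
    with xy A show ?thesis by (simp add: Q(2) mm assoc_algebra_def)
  qed
  ultimately show ?thesis unfolding assoc_algebra_def by (intro conjI Q(1) allI ballI) simp_all
qed

lemma lower_central_subset_carrier:
  assumes A: "assoc_algebra A"
  shows "lower_central A j \<subseteq> carrier A"
  using A
proof (induction A j rule: lower_central.induct)
  case (3 A i)
  interpret M: Module.module class_ring A using 3 by (simp add: assoc_algebra_def)
  interpret R: ring A using 3 by (simp add: assoc_algebra_def)
  show ?case unfolding lower_central.simps
    by (rule M.span_is_subset2) (use 3 in \<open>auto simp: a_minus_def\<close>)
qed auto

lemma lower_central_quotient_vectorspace:
  assumes A: "assoc_algebra A" and i: "i \<ge> 1"
  shows "vectorspace class_ring (lower_central_quotient A i)"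
proof -
  interpret M: Module.module class_ring A using assms by (simp add: assoc_algebra_def)
  interpret R: ring A using assms by (simp add: assoc_algebra_def)
  note sub = lower_central_subset_carrier[OF A]
  have Id: "ideal (lower_central_ideal A j) A" for j
    unfolding lower_central_ideal_def using sub by (rule R.genideal_ideal)
  have sm: "submodule class_ring (lower_central_ideal A j) A" for j
  proof -
    interpret J: ideal "lower_central_ideal A j" A by (rule Id)
    show ?thesis
    by (rule submodule.intro) (use ideal_smult[OF A Id] in \<open>auto intro: M.module_axioms J.a_Hcarr\<close>)
  qed
  have Lsub: "lower_central A (Suc i) \<subseteq> lower_central_ideal A i"
  proof -
    obtain j where j: "i = Suc j" using i by (cases i) auto
    interpret J: ideal "lower_central_ideal A i" A by (rule Id)
    have L: "lower_central A i \<subseteq> lower_central_ideal A i"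
      unfolding lower_central_ideal_def using sub by (rule R.genideal_self)
    have "{a \<otimes>\<^bsub>A\<^esub> l \<ominus>\<^bsub>A\<^esub> l \<otimes>\<^bsub>A\<^esub> a | a l. a \<in> carrier A \<and> l \<in> lower_central A (Suc j)} \<subseteq> lower_central_ideal A i"
    proof clarify
      fix a l assume "a \<in> carrier A" "l \<in> lower_central A (Suc j)"
      then have "a \<otimes>\<^bsub>A\<^esub> l \<in> lower_central_ideal A i" "l \<otimes>\<^bsub>A\<^esub> a \<in> lower_central_ideal A i"
        using L j J.I_l_closed J.I_r_closed by auto
      then show "a \<otimes>\<^bsub>A\<^esub> l \<ominus>\<^bsub>A\<^esub> l \<otimes>\<^bsub>A\<^esub> a \<in> lower_central_ideal A i"
        unfolding a_minus_def by (intro J.a_closed J.a_inv_closed)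
    qed
    with sm[of i] show ?thesis unfolding j lower_central.simps
      by (intro M.span_is_subset) 
  qed
  have MM: "lower_central_ideal A (Suc i) \<subseteq> lower_central_ideal A i"
    unfolding lower_central_ideal_def[of A "Suc i"] using Id Lsub by (rule R.genideal_minimal)
  let ?B = "A\<lparr>carrier := lower_central_ideal A i\<rparr>"
  have B: "Module.module class_ring ?B" using M.submodule_is_module[OF sm] .
  interpret B: Module.module class_ring ?B by (rule B)
  interpret J: ideal "lower_central_ideal A (Suc i)" A by (rule Id)
  have "additive_subgroup (lower_central_ideal A (Suc i)) ?B"
  proof (rule additive_subgroupI, rule B.add.subgroupI)
    fix a assume a: "a \<in> lower_central_ideal A (Suc i)"
    then have m: "(\<ominus>\<^bsub>A\<^esub> a) \<in> lower_central_ideal A (Suc i)" by simp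
    have "(\<ominus>\<^bsub>A\<^esub> a) \<oplus>\<^bsub>?B\<^esub> a = \<zero>\<^bsub>?B\<^esub>" using J.a_Hcarr[OF a] by (simp add: M.l_neg)
    moreover have "a \<in> carrier ?B" "(\<ominus>\<^bsub>A\<^esub> a) \<in> carrier ?B" using a m MM by auto
    ultimately have *: "\<ominus>\<^bsub>?B\<^esub> a = \<ominus>\<^bsub>A\<^esub> a" by (rule B.minus_equality)
    show "a_inv ?B a \<in> lower_central_ideal A (Suc i)" unfolding * using m .
  next
    show "lower_central_ideal A (Suc i) \<noteq> {}" using J.zero_closed by blast
  qed (use MM in \<open>auto\<close>)
  then have "Module.module class_ring (lower_central_quotient A i)"
    unfolding lower_central_quotient_def by (rule module_quotient_algebra(1)[OF B]) (use ideal_smult[OF A Id] in simp)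
  then show ?thesis by (intro vectorspace.intro class_field.field_axioms)
qed

lemma lower_central_quotient_vectorspace_free:
  "i \<ge> 1 \<Longrightarrow> vectorspace class_ring (lower_central_quotient 
   (quotient_algebra (free_algebra :: ('k::field, ('n,'k) ncpoly) module) (Idl\<^bsub>free_algebra\<^esub> F)) i)"
proof (intro lower_central_quotient_vectorspace assoc_algebra_quotient assoc_algebra_free_algebra)
  interpret ring "free_algebra :: ('k, ('n,'k) ncpoly) module"
    using assoc_algebra_free_algebra unfolding assoc_algebra_def by blast
  show "ideal (Idl\<^bsub>free_algebra\<^esub> F) (free_algebra :: ('k, ('n,'k) ncpoly) module)"
    by (rule genideal_ideal) simp
qed

end

theory Submission
  imports Defs
begin

text \<open>
  On the free algebra let \<open>D v r\<close> (\<open>hasse v r\<close> below) be the divided power \<open>\<partial>\<^sub>v\<^sup>r / r!\<close>, that is, the coefficient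
  of \<open>t\<^sup>r\<close> in the substitution \<open>x\<^sub>v \<mapsto> x\<^sub>v + t\<close>.  As
  \<open>(x\<^sub>v + t)\<^sup>q = x\<^sub>v\<^sup>q + t\<^sup>q\<close> for \<open>q = p ^ e v\<close>, the operators with \<open>0 < r < q\<close> kill the
  relations.  By the Leibniz rule they descend to \<open>A\<close>, preserve the lower central series and
  its ideals, and therefore act on \<open>N\<^sub>i(A)\<close>, as does left multiplication by \<open>x\<^sub>v\<close>.

  Let \<open>V\<close> be finite dimensional with such operators for one variable, and let \<open>W\<close> be the
  common kernel of the \<open>D r\<close> with \<open>0 < r < q\<close>.  On the subspace \<open>U (Suc k)\<close> killed by all
  \<open>D r\<close> with \<open>k < r < q\<close>, the operator \<open>D k\<close> has kernel \<open>U k\<close> and image \<open>W\<close>, since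
  \<open>D k (x ^ k w) = w\<close> for \<open>w \<in> W\<close>.  Hence \<open>dim V = q * dim W\<close>.  The operators of the other
  variables preserve \<open>W\<close>, so the variables can be treated one after the other; multiplications
  by different variables need not commute with each other.
\<close>

section \<open>Actions of divided power differential operators\<close>

text \<open>Independence in \<open>W\<close> is the same as in \<open>V\<close>, so independent
  subsets of \<open>W\<close> have at most \<open>dim\<close> elements, and a maximal one is a
  finite basis.\<close>

lemma (in vectorspace) fin_dim_subspace:
  assumes fd: fin_dim and W: "submodule K W V"
  shows "vectorspace.fin_dim K (vs W)"
proof -
  interpret W: vectorspace K "vs W"
    using submodule_is_module[OF W] by (intro vectorspace.intro) (auto intro: field_axioms)
  have WV: "W \<subseteq> carrier V" using W by (simp add: submodule_def)
  have li: "W.lin_indpt S \<longleftrightarrow> lin_indpt S" if "S \<subseteq> W" for S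
    using span_li_not_depend(2)[OF that W] by simp
  have bound: "finite S \<and> card S \<le> dim" if "S \<subseteq> W \<and> W.lin_indpt S" for S
    using that li[of S] li_le_dim[OF fd, of S] WV by auto
  have "\<not> W.lin_dep {}" unfolding W.lin_dep_def by auto
  then obtain S where S: "finite S" "maximal S (\<lambda>S. S \<subseteq> carrier (vs W) \<and> W.lin_indpt S)"
    using maximal_exists[of "\<lambda>S. S \<subseteq> carrier (vs W) \<and> W.lin_indpt S" dim "{}"] bound by auto
  then have "W.basis S" by (intro W.max_li_is_basis)
  then show ?thesis using S(1) unfolding W.fin_dim_def W.basis_def by blast
qed

text \<open>The axioms are the relations between multiplication by a variable and divided powers,
  truncated at order \<open>q v\<close>. Orders from \<open>q v\<close> on carry no meaning, so
  \<open>D_D\<close> cannot cover \<open>r + s \<ge> q v\<close> and \<open>D_D_zero\<close> takes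
  its place.\<close>

locale weyl_action = Module.module class_ring M
  for M :: "('k::field, 'a) module" +
  fixes q :: "'n \<Rightarrow> nat" and S :: "'n set"
    and X :: "'n \<Rightarrow> 'a \<Rightarrow> 'a" and D :: "'n \<Rightarrow> nat \<Rightarrow> 'a \<Rightarrow> 'a"
  assumes X_hom: "v \<in> S \<Longrightarrow> X v \<in> LinearCombinations.module_hom class_ring M M"
    and D_hom: "v \<in> S \<Longrightarrow> r < q v \<Longrightarrow> D v r \<in> LinearCombinations.module_hom class_ring M M"
    and D_0: "v \<in> S \<Longrightarrow> 0 < q v \<Longrightarrow> x \<in> carrier M \<Longrightarrow> D v 0 x = x"
    and D_X: "v \<in> S \<Longrightarrow> Suc r < q v \<Longrightarrow> x \<in> carrier M \<Longrightarrow>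
      D v (Suc r) (X v x) = X v (D v (Suc r) x) \<oplus>\<^bsub>M\<^esub> D v r x"
    and D_D: "v \<in> S \<Longrightarrow> r + s < q v \<Longrightarrow> x \<in> carrier M \<Longrightarrow>
      D v r (D v s x) = of_nat (r + s choose r) \<odot>\<^bsub>M\<^esub> D v (r + s) x"
    and D_D_zero: "v \<in> S \<Longrightarrow> r < q v \<Longrightarrow> s < q v \<Longrightarrow> r + s \<ge> q v \<Longrightarrow> x \<in> carrier M \<Longrightarrow>
      D v r (D v s x) = \<zero>\<^bsub>M\<^esub>"
    and D_X_commute: "u \<in> S \<Longrightarrow> v \<in> S \<Longrightarrow> u \<noteq> v \<Longrightarrow> r < q u \<Longrightarrow> x \<in> carrier M \<Longrightarrow>
      D u r (X v x) = X v (D u r x)"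
    and D_D_commute: "u \<in> S \<Longrightarrow> v \<in> S \<Longrightarrow> u \<noteq> v \<Longrightarrow> r < q u \<Longrightarrow> s < q v \<Longrightarrow> x \<in> carrier M \<Longrightarrow>
      D u r (D v s x) = D v s (D u r x)"

lemma module_hom_restrict:
  assumes "f \<in> LinearCombinations.module_hom class_ring M M'" "N \<subseteq> carrier M" "\<And>x. x \<in> N \<Longrightarrow> f x \<in> N'"
  shows "f \<in> LinearCombinations.module_hom class_ring (M\<lparr>carrier := N\<rparr>) (M'\<lparr>carrier := N'\<rparr>)"
  using assms unfolding LinearCombinations.module_hom_def by (auto simp: subset_iff)

lemma module_hom_zero:
  assumes "f \<in> LinearCombinations.module_hom class_ring M N" "Module.module class_ring M" "Module.module class_ring N"
  shows "f \<zero>\<^bsub>M\<^esub> = \<zero>\<^bsub>N\<^esub>"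
proof -
  interpret mod_hom class_ring M N f
    using assms by (intro mod_hom.intro mod_hom_axioms.intro)
  show ?thesis by simp
qed

section \<open>The kernel filtration and the dimension formula for one variable\<close>

context weyl_action
begin

lemma X_closed: "v \<in> S \<Longrightarrow> x \<in> carrier M \<Longrightarrow> X v x \<in> carrier M"
  using X_hom[of v] by (auto simp: LinearCombinations.module_hom_def)

lemma D_closed: "v \<in> S \<Longrightarrow> r < q v \<Longrightarrow> x \<in> carrier M \<Longrightarrow> D v r x \<in> carrier M"
  using D_hom[of v r] by (auto simp: LinearCombinations.module_hom_def)

lemma D_zero: "v \<in> S \<Longrightarrow> r < q v \<Longrightarrow> D v r \<zero>\<^bsub>M\<^esub> = \<zero>\<^bsub>M\<^esub>"
  by (rule module_hom_zero[OF D_hom module_axioms module_axioms])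

lemma X_zero: "v \<in> S \<Longrightarrow> X v \<zero>\<^bsub>M\<^esub> = \<zero>\<^bsub>M\<^esub>"
  by (rule module_hom_zero[OF X_hom module_axioms module_axioms])

lemma weyl_action_mono:
  assumes "T \<subseteq> S" shows "weyl_action M q T X D"
  by (intro weyl_action.intro weyl_action_axioms.intro module_axioms X_hom D_hom D_0 D_X D_D
      D_D_zero D_X_commute D_D_commute subsetD[OF assms])

lemma weyl_action_submodule:
  assumes N: "submodule class_ring N M"
    and X: "\<And>v x. v \<in> S \<Longrightarrow> x \<in> N \<Longrightarrow> X v x \<in> N"
    and D: "\<And>v r x. v \<in> S \<Longrightarrow> r < q v \<Longrightarrow> x \<in> N \<Longrightarrow> D v r x \<in> N"
  shows "weyl_action (M\<lparr>carrier := N\<rparr>) q S X D"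
proof -
  have NM: "N \<subseteq> carrier M" using N by (simp add: submodule_def)
  then have *: "x \<in> carrier M" if "x \<in> carrier (M\<lparr>carrier := N\<rparr>)" for x using that by auto
  show ?thesis
    by (intro weyl_action.intro weyl_action_axioms.intro submodule_is_module[OF N]
        module_hom_restrict X_hom D_hom NM X D)
      (use * in \<open>simp_all add: D_0 D_X D_D D_D_zero D_X_commute D_D_commute\<close>)
qed

text \<open>The space \<open>U k\<close> of the overview. For \<open>v\<close> in \<open>S\<close>
  and positive \<open>q v\<close> it grows from zero at \<open>k = 0\<close> to the whole module at
  \<open>k = q v\<close>; \<open>vanish v 1\<close> is \<open>W\<close>.\<close>

definition vanish :: "'n \<Rightarrow> nat \<Rightarrow> 'a set" where
  "vanish v k = {x \<in> carrier M. \<forall>r. k \<le> r \<longrightarrow> r < q v \<longrightarrow> D v r x = \<zero>\<^bsub>M\<^esub>}"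

lemma submodule_vanish: "v \<in> S \<Longrightarrow> submodule class_ring (vanish v k) M"
proof (rule submodule.intro[OF module_axioms])
  assume v: "v \<in> S"
  note hom = LinearCombinations.module_hom_add[OF D_hom[OF v]] LinearCombinations.module_hom_smult[OF D_hom[OF v]]
  show "x \<oplus>\<^bsub>M\<^esub> y \<in> vanish v k" if "x \<in> vanish v k" "y \<in> vanish v k" for x y
    using that by (auto simp: vanish_def hom)
  show "c \<odot>\<^bsub>M\<^esub> x \<in> vanish v k" if "c \<in> carrier class_ring" "x \<in> vanish v k" for c x
    using that smult_closed[of c x] smult_r_null[of c] by (auto simp: vanish_def hom)
  show "\<zero>\<^bsub>M\<^esub> \<in> vanish v k" using v by (auto simp: vanish_def D_zero)
qed (auto simp: vanish_def)

text \<open>By \<open>D_X\<close>, applying \<open>X v\<close> raises the filtration index by one,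
  and \<open>D v (Suc k)\<close> of \<open>X v y\<close> equals \<open>D v k y\<close> once
  \<open>D v (Suc k)\<close> kills \<open>y\<close>. Thus \<open>X v ^^ k\<close> is a right inverse
  of \<open>D v k\<close> over \<open>W\<close>.\<close>

lemma X_power_vanish:
  assumes v: "v \<in> S" and w: "w \<in> vanish v 1" and k: "k < q v"
  shows "(X v ^^ k) w \<in> vanish v (Suc k) \<and> D v k ((X v ^^ k) w) = w"
  using k
proof (induction k)
  case 0
  then show ?case using w v by (simp add: vanish_def D_0)
next
  case (Suc k)
  let ?y = "(X v ^^ k) w"
  have y: "?y \<in> vanish v (Suc k)" "D v k ?y = w" using Suc by simp_all
  then have yM: "?y \<in> carrier M" by (simp add: vanish_def)
  have "D v r (X v ?y) = \<zero>\<^bsub>M\<^esub>" if r: "Suc (Suc k) \<le> r" "r < q v" for r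
  proof -
    obtain s where s: "r = Suc s" using r by (cases r) auto
    have "D v (Suc s) ?y = \<zero>\<^bsub>M\<^esub>" "D v s ?y = \<zero>\<^bsub>M\<^esub>" using y r s by (simp_all add: vanish_def)
    then show ?thesis using D_X[OF v, of s ?y] yM r s by (simp add: X_zero v)
  qed
  moreover have "w \<in> carrier M" "D v (Suc k) ?y = \<zero>\<^bsub>M\<^esub>"
    using w y Suc.prems by (simp_all add: vanish_def)
  ultimately show ?case
    using D_X[OF v, of k ?y] yM y(2) Suc.prems by (simp add: vanish_def X_closed X_zero v)
qed

lemma dim_eq_vanish:
  assumes fd: "vectorspace.fin_dim class_ring M" and v: "v \<in> S" and q: "q v > 0"
  shows "vectorspace.dim class_ring M =
    q v * vectorspace.dim class_ring (M\<lparr>carrier := vanish v 1\<rparr>)"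
proof -
  interpret V: vectorspace class_ring M by (intro vectorspace.intro module_axioms class_field.field_axioms)
  let ?V = "\<lambda>k. M\<lparr>carrier := vanish v k\<rparr>"
  let ?d = "\<lambda>k. vectorspace.dim class_ring (?V k)"
  note sub = submodule_vanish[OF v]
  have vsp: "vectorspace class_ring (?V k)" for k
    by (intro vectorspace.intro submodule_is_module sub class_field.field_axioms)
  have step: "?d (Suc k) = ?d 1 + ?d k" if k: "k < q v" for k
  proof -
    \<comment> \<open>Applying a further \<open>D v r\<close> with \<open>r \<ge> 1\<close> gives a
      multiple of \<open>D v (r + k) x\<close>, which is zero as \<open>r + k > k\<close>, or zero
      outright when \<open>r + k \<ge> q v\<close>.\<close>
    have img: "D v k x \<in> vanish v 1" if x: "x \<in> vanish v (Suc k)" for x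
    proof -
      have xM: "x \<in> carrier M" using x by (simp add: vanish_def)
      have "D v r (D v k x) = \<zero>\<^bsub>M\<^esub>" if r: "1 \<le> r" "r < q v" for r
      proof (cases "r + k < q v")
        case True
        have "D v (r + k) x = \<zero>\<^bsub>M\<^esub>" using x r True by (simp add: vanish_def)
        then show ?thesis using D_D[OF v True xM] smult_r_null by simp
      next
        case False
        then show ?thesis using D_D_zero[OF v r(2) k _ xM] by simp
      qed
      then show ?thesis using D_closed[OF v k xM] by (simp add: vanish_def)
    qed
    have "linear_map class_ring (?V (Suc k)) (?V 1) (D v k)"
      by (intro linear_map.intro vsp mod_hom.intro mod_hom_axioms.intro vectorspace.axioms(1)[OF vsp]
          module_hom_restrict D_hom[OF v k] img) (auto simp: vanish_def)
    then interpret T: linear_map class_ring "?V (Suc k)" "?V 1" "D v k" .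
    have im: "T.imT = vanish v 1"
    proof
      \<comment> \<open>The preimage of \<open>w\<close> is \<open>(X v ^^ k) w\<close>.\<close>
      show "vanish v 1 \<subseteq> T.imT"
        using X_power_vanish[OF v _ k] unfolding T.im_def by (force simp: image_iff)
    qed (use img in \<open>auto simp: T.im_def\<close>)
    have ker: "T.kerT = vanish v k"
      unfolding T.ker_def using k by (auto simp: vanish_def) (metis Suc_leI le_neq_implies_less)
    have "T.V.fin_dim" by (rule V.fin_dim_subspace[OF fd sub])
    from T.rank_nullity[OF this] show ?thesis unfolding im ker by simp
  qed
  have "?d k = k * ?d 1" if "k \<le> q v" for k
    using that
  proof (induction k)
    case 0
    \<comment> \<open>The condition at order 0 forces \<open>x\<close> to be zero because
      \<open>D v 0\<close> is the identity.\<close>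
    have van: "vanish v 0 = {\<zero>\<^bsub>M\<^esub>}"
      using q v D_0[OF v] by (auto simp: vanish_def D_zero)
    interpret Z: vectorspace class_ring "?V 0" by (rule vsp)
    have "Z.span (vanish v 0) = vanish v 0"
      using Z.in_own_span[of "vanish v 0"] Z.span_is_subset2[of "vanish v 0"] by auto
    then show ?case using Z.dim0I van by simp
  next
    case (Suc k)
    then show ?case using step[of k] by simp
  qed
  moreover have "vanish v (q v) = carrier M" by (auto simp: vanish_def)
  ultimately show ?thesis by (metis V.carrier_vs_is_self order_refl partial_object.surjective partial_object.update_convs(1))
qed

end

text \<open>Each variable contributes its factor by \<open>dim_eq_vanish\<close>. \<open>M\<close>
  is generalised in the induction because the hypothesis is applied to the constants of
  \<open>v\<close>, not to \<open>M\<close> itself.\<close>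

lemma weyl_action_dvd_dim:
  assumes "finite S" "weyl_action M q S X D" "vectorspace.fin_dim class_ring M"
    and "\<And>v. v \<in> S \<Longrightarrow> q v > 0"
  shows "(\<Prod>v\<in>S. q v) dvd vectorspace.dim class_ring M"
  using assms
proof (induction S arbitrary: M rule: finite_induct)
  case (insert v S)
  interpret weyl_action M q "insert v S" X D by fact
  interpret V: vectorspace class_ring M by (intro vectorspace.intro module_axioms class_field.field_axioms)
  let ?W = "vanish v 1"
  have sub: "submodule class_ring ?W M" by (rule submodule_vanish) simp
  interpret S: weyl_action M q S X D by (rule weyl_action_mono) auto
  have "weyl_action (M\<lparr>carrier := ?W\<rparr>) q S X D"
  proof (rule S.weyl_action_submodule[OF sub])
    fix u x assume u: "u \<in> S" and x: "x \<in> ?W"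
    then have uv: "u \<noteq> v" using insert.hyps by auto
    have xM: "x \<in> carrier M" using x by (simp add: vanish_def)
    show "X u x \<in> ?W"
      using u uv x xM by (auto simp: vanish_def X_closed D_X_commute X_zero)
    show "D u r x \<in> ?W" if r: "r < q u" for r
    proof -
      have "D v s (D u r x) = \<zero>\<^bsub>M\<^esub>" if "1 \<le> s" "s < q v" for s
        using D_D_commute[of v u s r x] u uv x xM r that by (simp add: vanish_def D_zero)
      then show ?thesis using u r xM by (simp add: vanish_def D_closed)
    qed
  qed
  then have "(\<Prod>v\<in>S. q v) dvd vectorspace.dim class_ring (M\<lparr>carrier := ?W\<rparr>)"
    using V.fin_dim_subspace[OF insert.prems(2) sub] insert.prems(3) by (intro insert.IH) auto
  then show ?case
    using insert.hyps dim_eq_vanish[OF insert.prems(2), of v] insert.prems(3)[of v] by simp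
qed simp

section \<open>Divided power derivations of the free algebra\<close>

lemma single_zero_central:
  "f * Poly_Mapping.single 0 c = Poly_Mapping.single 0 c * (f :: ('n, 'k::field) ncpoly)"
  by (metis map_eq_single_mult map_eq_mult_single)

lemma monomial_induct [case_names single add]:
  fixes f :: "('n, 'k::field) ncpoly"
  assumes single: "\<And>w c. P (Poly_Mapping.single (Word w) c)"
    and add: "\<And>f g. P f \<Longrightarrow> P g \<Longrightarrow> P (f + g)"
  shows "P f"
proof (induction f rule: update_induct)
  case const
  then show ?case using single[of "[]" 0] by simp
next
  case (update f a b)
  have "Poly_Mapping.update a b f = f + Poly_Mapping.single a b"
    using update by (intro poly_mapping_eqI)
      (auto simp: Poly_Mapping.lookup_update lookup_add lookup_single when_def in_keys_iff)
  then show ?case using add[OF update.IH, of "Poly_Mapping.single a b"] single by (cases a) simp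
qed

text \<open>Words are built by prepending letters, which matches the recursion of the divided powers
  on the first letter.\<close>

lemma ncpoly_induct [case_names one smult var add]:
  fixes f :: "('n, 'k::field) ncpoly"
  assumes one: "P 1"
    and smult: "\<And>c f. P f \<Longrightarrow> P (Poly_Mapping.single 0 c * f)"
    and var: "\<And>v f. P f \<Longrightarrow> P (ncvar v * f)"
    and add: "\<And>f g. P f \<Longrightarrow> P g \<Longrightarrow> P (f + g)"
  shows "P f"
proof (induction f rule: monomial_induct)
  case (single w c)
  have "P (Poly_Mapping.single (Word w) 1)"
  proof (induction w)
    case Nil
    then show ?case using one by (simp flip: zero_free_monoid_def)
  next
    case (Cons a w)
    then show ?case using var[OF Cons, of a] by (simp add: ncvar_def mult_single)
  qed
  from smult[OF this, of c] show ?case by (simp add: mult_single)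
qed (rule add)

text \<open>The sum of the words left after deleting \<open>r\<close> occurrences of
  \<open>v\<close> from the given word, over all choices of positions. This is the divided power
  without a division by \<open>r!\<close>, so it makes sense in characteristic
  \<open>p\<close>.\<close>

fun hasse_word :: "'n \<Rightarrow> nat \<Rightarrow> 'n list \<Rightarrow> ('n, 'k::field) ncpoly" where
  "hasse_word v 0 w = Poly_Mapping.single (Word w) 1"
| "hasse_word v (Suc r) [] = 0"
| "hasse_word v (Suc r) (a # w) =
     ncvar a * hasse_word v (Suc r) w + (if a = v then hasse_word v r w else 0)"

definition hasse :: "'n \<Rightarrow> nat \<Rightarrow> ('n, 'k::field) ncpoly \<Rightarrow> ('n, 'k) ncpoly" where
  "hasse v r f = (\<Sum>x\<in>Poly_Mapping.keys f.
     Poly_Mapping.single 0 (Poly_Mapping.lookup f x) * hasse_word v r (case x of Word w \<Rightarrow> w))"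

lemma hasse_add: "hasse v r (f + g) = hasse v r f + hasse v r g"
  unfolding hasse_def by (rule setsum_keys_plus_distrib) (simp_all add: single_add distrib_right)

lemma hasse_single:
  "hasse v r (Poly_Mapping.single (Word w) c) = Poly_Mapping.single 0 c * hasse_word v r w"
  by (simp add: hasse_def)

lemma hasse_0 [simp]: "hasse v r 0 = 0"
  by (simp add: hasse_def)

lemma hasse_uminus: "hasse v r (- f) = - hasse v r f"
  using hasse_add[of v r f "- f"] by (simp add: eq_neg_iff_add_eq_0 add.commute)

lemma hasse_diff: "hasse v r (f - g) = hasse v r f - hasse v r g"
  using hasse_add[of v r f "- g"] by (simp add: hasse_uminus)

lemma hasse_single_mult:
  "hasse v r (Poly_Mapping.single 0 c * f) = Poly_Mapping.single 0 c * hasse v r f"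
proof (induction f rule: monomial_induct)
  case (single w d)
  then show ?case by (simp add: mult_single hasse_single flip: mult.assoc)
qed (simp add: hasse_add distrib_left)

lemma hasse_one [simp]: "hasse v r 1 = (if r = 0 then 1 else 0)"
  using hasse_single[of v r "[]" 1] by (cases r) (simp_all flip: zero_free_monoid_def)

lemma hasse_zero_order [simp]: "hasse v 0 f = f"
  by (induction f rule: monomial_induct) (simp_all add: hasse_single hasse_add mult_single)

text \<open>Under the substitution the factor \<open>x_v\<close> becomes \<open>x_v + t\<close>, and
  its summand \<open>t\<close> lowers the order left for \<open>f\<close> by one. The guard
  \<open>r > 0\<close> keeps the truncated \<open>r - 1\<close> from counting at
  \<open>r = 0\<close>.\<close>

lemma hasse_ncvar_mult:
  "hasse v r (ncvar a * f) =
     ncvar a * hasse v r f + (if a = v \<and> r > 0 then hasse v (r - 1) f else 0)"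
proof (induction f rule: monomial_induct)
  case (single w c)
  have "ncvar a * Poly_Mapping.single (Word w) c = Poly_Mapping.single (Word (a # w)) c"
    by (simp add: ncvar_def mult_single)
  moreover have "Poly_Mapping.single 0 c * (ncvar a * g) = ncvar a * (Poly_Mapping.single 0 c * g)"
    for g :: "('a, 'b) ncpoly"
    by (metis mult.assoc single_zero_central)
  ultimately show ?case
    by (cases r) (simp_all add: hasse_single distrib_left mult_single ncvar_def)
qed (simp add: hasse_add distrib_left)

text \<open>The substitution of \<open>x_v + t\<close> for \<open>x_v\<close>, with \<open>t\<close>
  central, is multiplicative; comparing coefficients of \<open>t^r\<close> gives this Leibniz rule,
  with the order of the factors preserved.\<close>

lemma hasse_mult: "hasse v r (f * g) = (\<Sum>s\<le>r. hasse v s f * hasse v (r - s) g)"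
proof (induction f arbitrary: r rule: ncpoly_induct)
  case one
  have "(\<Sum>s\<le>r. hasse v s 1 * hasse v (r - s) g) = (\<Sum>s\<in>{0}. hasse v s 1 * hasse v (r - s) g)"
    by (rule sum.mono_neutral_right) auto
  then show ?case by simp
next
  case (smult c f)
  then show ?case by (simp add: hasse_single_mult mult.assoc sum_distrib_left)
next
  case (var a f)
  show ?case
  proof (cases r)
    case 0
    then show ?thesis by (simp add: mult.assoc)
  next
    case (Suc m)
    have "(\<Sum>s\<le>Suc m. hasse v s (ncvar a * f) * hasse v (Suc m - s) g) =
      ncvar a * (\<Sum>s\<le>Suc m. hasse v s f * hasse v (Suc m - s) g) +
      (\<Sum>s\<le>Suc m. (if a = v \<and> s > 0 then hasse v (s - 1) f else 0) * hasse v (Suc m - s) g)"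
      by (simp only: hasse_ncvar_mult distrib_right sum.distrib sum_distrib_left mult.assoc)
    \<comment> \<open>The term at \<open>s = 0\<close> is zero, and shifting the index turns the
      rest into the Leibniz sum of order \<open>m\<close>.\<close>
    also have "(\<Sum>s\<le>Suc m. (if a = v \<and> s > 0 then hasse v (s - 1) f else 0) * hasse v (Suc m - s) g) =
      (if a = v then \<Sum>s\<le>m. hasse v s f * hasse v (m - s) g else 0)"
      by (subst sum.atMost_Suc_shift) simp
    finally show ?thesis
      unfolding Suc by (simp only: var.IH mult.assoc hasse_ncvar_mult) simp
  qed
next
  case (add f1 f2)
  then show ?case by (simp add: hasse_add distrib_right sum.distrib)
qed

text \<open>Substituting twice, with parameters \<open>t\<close> and \<open>u\<close>, is
  substituting once with \<open>t + u\<close>; the binomial is the coefficient in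
  \<open>(t + u)^(r + s)\<close>.\<close>

lemma hasse_hasse: "hasse v r (hasse v s f) = of_nat (r + s choose r) * hasse v (r + s) f"
proof (induction f arbitrary: r s rule: ncpoly_induct)
  case one
  then show ?case by simp
next
  case (smult c f)
  then show ?case by (simp add: hasse_single_mult) (metis mult.assoc single_zero_central mult_of_nat_commute)
next
  case (var a f)
  show ?case
  proof (cases "a = v \<and> r > 0 \<and> s > 0")
    case True
    then obtain m n where mn: "r = Suc m" "s = Suc n" by (auto simp: gr0_conv_Suc)
    \<comment> \<open>The orders \<open>(Suc m, n)\<close> and \<open>(m, Suc n)\<close> of the
      induction hypothesis combine by Pascal's rule.\<close>
    show ?thesis using True
      by (simp add: mn hasse_ncvar_mult hasse_add var.IH distrib_left distrib_right mult.assoc)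
        (simp add: algebra_simps mult_of_nat_commute)
  next
    case False
    then show ?thesis
      by (cases "r = 0"; cases "s = 0")
        (auto simp: hasse_ncvar_mult hasse_add var.IH distrib_left mult.assoc mult_of_nat_commute)
  qed
next
  case (add f1 f2)
  then show ?case by (simp add: hasse_add distrib_left)
qed

lemma hasse_commute: "u \<noteq> v \<Longrightarrow> hasse u r (hasse v s f) = hasse v s (hasse u r f)"
proof (induction f arbitrary: r s rule: ncpoly_induct)
  case (var a f)
  then show ?case by (simp add: hasse_ncvar_mult hasse_add)
qed (simp_all add: hasse_single_mult hasse_add)

text \<open>The binomial expansion of \<open>(x_v + t)^n\<close>. For \<open>r > n\<close> the
  coefficient is zero, so the truncated exponent does no harm.\<close>

lemma hasse_ncvar_power:
  "hasse v r (ncvar v ^ n) = of_nat (n choose r) * ncvar v ^ (n - r)"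
proof (induction n arbitrary: r)
  case 0
  then show ?case by (simp add: binomial_eq_0)
next
  case (Suc n)
  show ?case
  proof (cases r)
    case r: (Suc m)
    show ?thesis
    proof (cases "n \<ge> Suc m")
      case True
      then have "n - m = Suc (n - Suc m)" by simp
      moreover have "ncvar v * (of_nat k * g) = of_nat k * (ncvar v * g)" for k g
        by (metis mult.assoc mult_of_nat_commute)
      ultimately show ?thesis unfolding r
        by (simp add: hasse_ncvar_mult Suc.IH distrib_right)
    next
      case False
      then show ?thesis unfolding r by (simp add: hasse_ncvar_mult Suc.IH binomial_eq_0)
    qed
  qed simp
qed

lemma hasse_ncvar_power_other:
  "u \<noteq> v \<Longrightarrow> hasse v r (ncvar u ^ n) = (if r = 0 then ncvar u ^ n else 0)"
  by (induction n) (simp_all add: hasse_ncvar_mult)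

section \<open>Induced operators on quotients\<close>

lemma (in Module.module) submodule_additive_subgroup:
  assumes "submodule R N M" shows "additive_subgroup N M"
proof (rule additive_subgroupI, rule M.add.subgroupI)
  interpret N: submodule R N M by fact
  show "a_inv M x \<in> N" if "x \<in> N" for x
    using N.smult_closed[OF R.add.inv_closed[OF R.one_closed] that] that N.subset
    by (metis smult_minus_1 subsetD)
  show "N \<noteq> {}" using N.zero_closed by blast
qed (use assms in \<open>auto simp: submodule_def\<close>)

text \<open>The union avoids choosing a representative: if \<open>f\<close> is linear and preserves
  \<open>N\<close>, all its members are the same coset.\<close>

definition quotient_map :: "('k::field, 'a) module \<Rightarrow> 'a set \<Rightarrow> ('a \<Rightarrow> 'a) \<Rightarrow> 'a set \<Rightarrow> 'a set" where
  "quotient_map M N f Y = (\<Union>x\<in>Y. N +>\<^bsub>M\<^esub> f x)"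

context
  fixes M :: "('k::field, 'a) module" and N :: "'a set"
  assumes M: "Module.module class_ring M" and N: "submodule class_ring N M"
begin

interpretation M: Module.module class_ring M by (rule M)
interpretation N: submodule class_ring N M by (rule N)
interpretation N: additive_subgroup N M by (rule M.submodule_additive_subgroup[OF N])
interpretation N: abelian_subgroup N M
  by (rule abelian_subgroupI3) (rule N.additive_subgroup_axioms, unfold_locales)

lemmas module_quotient = module_quotient_algebra[OF M N.additive_subgroup_axioms N.smult_closed]

lemma carrier_quotient: "carrier (quotient_algebra M N) = (\<lambda>x. N +>\<^bsub>M\<^esub> x) ` carrier M"
  by (auto simp: quotient_algebra_simps A_RCOSETS_def')

lemma coset_zero: "N +>\<^bsub>M\<^esub> \<zero>\<^bsub>M\<^esub> = \<zero>\<^bsub>quotient_algebra M N\<^esub>"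
  using M.a_coset_add_zero[OF N.a_subset] by (simp add: quotient_algebra_simps)

lemma coset_add: "x \<in> carrier M \<Longrightarrow> y \<in> carrier M \<Longrightarrow>
    N +>\<^bsub>M\<^esub> (x \<oplus>\<^bsub>M\<^esub> y) = (N +>\<^bsub>M\<^esub> x) \<oplus>\<^bsub>quotient_algebra M N\<^esub> (N +>\<^bsub>M\<^esub> y)"
  by (simp add: quotient_algebra_simps N.a_rcos_sum)

lemma coset_smult: "x \<in> carrier M \<Longrightarrow>
    N +>\<^bsub>M\<^esub> (c \<odot>\<^bsub>M\<^esub> x) = c \<odot>\<^bsub>quotient_algebra M N\<^esub> (N +>\<^bsub>M\<^esub> x)"
  by (simp add: module_quotient(2))

lemma quotient_map_coset:
  assumes f: "f \<in> LinearCombinations.module_hom class_ring M M" "\<And>x. x \<in> N \<Longrightarrow> f x \<in> N"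
    and x: "x \<in> carrier M"
  shows "quotient_map M N f (N +>\<^bsub>M\<^esub> x) = N +>\<^bsub>M\<^esub> f x"
proof -
  have fM: "f y \<in> carrier M" if "y \<in> carrier M" for y
    using f(1) that by (auto simp: LinearCombinations.module_hom_def)
  have "N +>\<^bsub>M\<^esub> f y = N +>\<^bsub>M\<^esub> f x" if "y \<in> N +>\<^bsub>M\<^esub> x" for y
  proof -
    obtain h where h: "h \<in> N" "y = h \<oplus>\<^bsub>M\<^esub> x" using \<open>y \<in> N +>\<^bsub>M\<^esub> x\<close> by (auto simp: a_r_coset_def')
    have "f y = f h \<oplus>\<^bsub>M\<^esub> f x"
      using h x N.a_Hcarr by (simp add: LinearCombinations.module_hom_add[OF f(1)])
    then have "f y \<in> N +>\<^bsub>M\<^esub> f x" using f(2)[OF h(1)] by (auto simp: a_r_coset_def')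
    then show ?thesis using N.a_repr_independence' fM[OF x] by blast
  qed
  moreover have "x \<in> N +>\<^bsub>M\<^esub> x" using x N.a_rcos_self by blast
  ultimately show ?thesis unfolding quotient_map_def by blast
qed

lemma quotient_map_hom:
  assumes f: "f \<in> LinearCombinations.module_hom class_ring M M" "\<And>x. x \<in> N \<Longrightarrow> f x \<in> N"
  shows "quotient_map M N f \<in>
    LinearCombinations.module_hom class_ring (quotient_algebra M N) (quotient_algebra M N)"
proof -
  have fM: "f y \<in> carrier M" if "y \<in> carrier M" for y
    using f(1) that by (auto simp: LinearCombinations.module_hom_def)
  show ?thesis
    unfolding LinearCombinations.module_hom_def
  proof (intro CollectI conjI allI impI Pi_I; (elim conjE)?)
    let ?Q = "quotient_algebra M N"
    note f' = quotient_map_coset[OF f]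
    fix Y assume "Y \<in> carrier ?Q"
    then obtain y where y: "y \<in> carrier M" "Y = N +>\<^bsub>M\<^esub> y" by (auto simp: carrier_quotient)
    show "quotient_map M N f Y \<in> carrier ?Q"
      using y fM by (auto simp: f' carrier_quotient)
    show "quotient_map M N f (c \<odot>\<^bsub>?Q\<^esub> Y) = c \<odot>\<^bsub>?Q\<^esub> quotient_map M N f Y"
      if "c \<in> carrier class_ring" for c
      using y fM M.smult_closed[of c] that
      by (simp add: f' module_quotient(2) LinearCombinations.module_hom_smult[OF f(1)])
    fix Z assume "Z \<in> carrier ?Q"
    then obtain z where z: "z \<in> carrier M" "Z = N +>\<^bsub>M\<^esub> z" by (auto simp: carrier_quotient)
    show "quotient_map M N f (Y \<oplus>\<^bsub>?Q\<^esub> Z) = quotient_map M N f Y \<oplus>\<^bsub>?Q\<^esub> quotient_map M N f Z"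
      using y z fM by (simp add: f' LinearCombinations.module_hom_add[OF f(1)] flip: coset_add)
  qed
qed

text \<open>The operators preserve \<open>N\<close>, so every axiom can be checked on
  representatives.\<close>

lemma weyl_action_quotient:
  assumes W: "weyl_action M q S X D"
    and X: "\<And>v x. v \<in> S \<Longrightarrow> x \<in> N \<Longrightarrow> X v x \<in> N"
    and D: "\<And>v r x. v \<in> S \<Longrightarrow> r < q v \<Longrightarrow> x \<in> N \<Longrightarrow> D v r x \<in> N"
  shows "weyl_action (quotient_algebra M N) q S (\<lambda>v. quotient_map M N (X v))
    (\<lambda>v r. quotient_map M N (D v r))"
proof -
  interpret weyl_action M q S X D by (rule W)
  let ?Q = "quotient_algebra M N"
  have Xc: "quotient_map M N (X v) (N +>\<^bsub>M\<^esub> x) = N +>\<^bsub>M\<^esub> X v x"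
    if "v \<in> S" "x \<in> carrier M" for v x
    using that by (intro quotient_map_coset X_hom X)
  have Dc: "quotient_map M N (D v r) (N +>\<^bsub>M\<^esub> x) = N +>\<^bsub>M\<^esub> D v r x"
    if "v \<in> S" "r < q v" "x \<in> carrier M" for v r x
    using that by (intro quotient_map_coset D_hom D)
  note closed = X_closed D_closed
  show ?thesis
  proof (intro weyl_action.intro weyl_action_axioms.intro module_quotient(1))
    fix v Y assume v: "v \<in> S" and "Y \<in> carrier ?Q"
    then obtain x where x: "x \<in> carrier M" "Y = N +>\<^bsub>M\<^esub> x" by (auto simp: carrier_quotient)
    show "quotient_map M N (D v 0) Y = Y" if "0 < q v"
      using v x that by (simp add: Dc D_0)
    show "quotient_map M N (D v (Suc r)) (quotient_map M N (X v) Y) =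
        quotient_map M N (X v) (quotient_map M N (D v (Suc r)) Y) \<oplus>\<^bsub>?Q\<^esub> quotient_map M N (D v r) Y"
      if "Suc r < q v" for r
      using v x that by (simp add: Xc Dc closed D_X coset_add)
    show "quotient_map M N (D v r) (quotient_map M N (D v s) Y) =
        of_nat (r + s choose r) \<odot>\<^bsub>?Q\<^esub> quotient_map M N (D v (r + s)) Y"
      if "r + s < q v" for r s
      using v x that by (simp add: Dc closed D_D coset_smult)
    show "quotient_map M N (D v r) (quotient_map M N (D v s) Y) = \<zero>\<^bsub>?Q\<^esub>"
      if "r < q v" "s < q v" "q v \<le> r + s" for r s
      using v x that by (simp add: Dc closed D_D_zero coset_zero)
    fix u r assume u: "u \<in> S" "u \<noteq> v" "r < q u"
    show "quotient_map M N (D u r) (quotient_map M N (X v) Y) =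
        quotient_map M N (X v) (quotient_map M N (D u r) Y)"
      using u v x by (simp add: Xc Dc closed D_X_commute)
    show "quotient_map M N (D u r) (quotient_map M N (D v s) Y) =
        quotient_map M N (D v s) (quotient_map M N (D u r) Y)" if "s < q v" for s
      using u v x that D_D_commute[of u v r s x] by (simp add: Dc closed)
  qed (auto intro!: quotient_map_hom X_hom D_hom X D)
qed

end

section \<open>Characteristic \<open>p\<close>\<close>

text \<open>The product of \<open>k\<close> and \<open>p ^ e choose k\<close> is a multiple of
  \<open>p ^ e\<close>. If \<open>p\<close> did not divide the binomial, \<open>p ^ e\<close> would
  divide \<open>k\<close>, which is too small.\<close>

lemma prime_dvd_choose_prime_power:
  assumes "prime (p::nat)" "0 < k" "k < p ^ e"
  shows "p dvd (p ^ e choose k)"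
proof (rule ccontr)
  assume "\<not> p dvd (p ^ e choose k)"
  then have cop: "coprime (p ^ e) (p ^ e choose k)"
    using assms(1) by (simp add: prime_imp_coprime)
  obtain m where k: "k = Suc m" using assms(2) by (cases k) auto
  obtain n where n: "p ^ e = Suc n" using assms(3) by (cases "p ^ e") auto
  have "p ^ e dvd k * (p ^ e choose k)"
    using dvd_triv_left[of "Suc n" "n choose m"] by (simp only: k n Suc_times_binomial)
  with cop have "p ^ e dvd k" by (simp add: coprime_dvd_mult_left_iff)
  then have "p ^ e \<le> k" using assms(2) by (rule dvd_imp_le)
  then show False using assms(3) by simp
qed

text \<open>A case of Kummer's theorem: adding \<open>r\<close> and \<open>s\<close> in base
  \<open>p\<close> carries past digit \<open>e\<close>. Write \<open>r + s = p ^ e + n\<close> with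
  \<open>n < r\<close> and expand by Vandermonde: the term \<open>k = 0\<close> is zero since
  \<open>n < r\<close>, the others are divisible by \<open>p\<close>.\<close>

lemma prime_dvd_choose_carry:
  assumes p: "prime (p::nat)" and rs: "r < p ^ e" "s < p ^ e" "p ^ e \<le> r + s"
  shows "p dvd (r + s choose r)"
proof -
  define n where "n = r + s - p ^ e"
  have n: "r + s = p ^ e + n" "n < r" using rs by (auto simp: n_def)
  have "p dvd (p ^ e choose k) * (n choose (r - k))" if "k \<le> r" for k
  proof (cases "k = 0")
    case True
    then show ?thesis using n by (simp add: binomial_eq_0)
  next
    case False
    then have "p dvd (p ^ e choose k)" using that rs by (intro prime_dvd_choose_prime_power[OF p]) auto
    then show ?thesis by simp
  qed
  then have "p dvd (\<Sum>k\<le>r. (p ^ e choose k) * (n choose (r - k)))" by (intro dvd_sum) auto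
  then show ?thesis by (simp only: n(1) vandermonde)
qed

text \<open>Moves an integer factor into the field, where the characteristic applies. The
  simplification rule \<open>single_of_nat\<close> goes the other way and is removed wherever this
  is used.\<close>

lemma of_nat_eq_single: "(of_nat n :: ('n, 'k::field) ncpoly) = Poly_Mapping.single 0 (of_nat n)"
  by simp

lemma weyl_action_free_algebra:
  assumes p: "prime p" "CHAR('k::field) = p"
  shows "weyl_action (free_algebra :: ('k, ('n, 'k) ncpoly) module) (\<lambda>v. p ^ e v) UNIV
    (\<lambda>v f. ncvar v * f) hasse"
proof (intro weyl_action.intro weyl_action_axioms.intro)
  let ?F = "free_algebra :: ('k, ('n, 'k) ncpoly) module"
  show "Module.module class_ring ?F" using assoc_algebra_free_algebra unfolding assoc_algebra_def by blast
  fix v :: 'n and x :: "('n, 'k) ncpoly" and r s :: nat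
  have "ncvar v * (Poly_Mapping.single 0 c * g) = Poly_Mapping.single 0 c * (ncvar v * g)"
    for c :: 'k and g
    by (metis mult.assoc single_zero_central)
  then show "(\<lambda>f. ncvar v * f) \<in> LinearCombinations.module_hom class_ring ?F ?F"
    by (simp add: LinearCombinations.module_hom_def distrib_left)
  show "hasse v r \<in> LinearCombinations.module_hom class_ring ?F ?F"
    by (simp add: LinearCombinations.module_hom_def hasse_add hasse_single_mult)
  show "hasse v r (hasse v s x) = of_nat (r + s choose r) \<odot>\<^bsub>?F\<^esub> hasse v (r + s) x"
    by (simp add: hasse_hasse)
  show "hasse v r (hasse v s x) = \<zero>\<^bsub>?F\<^esub>" if "r < p ^ e v" "s < p ^ e v" "p ^ e v \<le> r + s"
  proof -
    have "(of_nat (r + s choose r) :: 'k) = 0"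
      using prime_dvd_choose_carry[OF p(1) that] by (simp add: of_nat_eq_0_iff_char_dvd p(2))
    then show ?thesis by (simp add: hasse_hasse of_nat_eq_single del: single_of_nat)
  qed
qed (simp_all add: hasse_ncvar_mult hasse_commute)

lemma hasse_ncvar_prime_power:
  assumes "prime p" "CHAR('k::field) = p" "0 < r" "r < p ^ e v"
  shows "hasse v r (ncvar u ^ (p ^ e u) :: ('n, 'k) ncpoly) = 0"
proof (cases "u = v")
  case True
  have "(of_nat (p ^ e v choose r) :: 'k) = 0"
    using prime_dvd_choose_prime_power[of p r "e v"] assms by (simp add: of_nat_eq_0_iff_char_dvd)
  then show ?thesis
    by (simp add: True hasse_ncvar_power of_nat_eq_single del: single_of_nat)
qed (use assms(3) in \<open>simp add: hasse_ncvar_power_other\<close>)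

text \<open>The elements killed by all these operators form a subalgebra, which contains the prime
  power generators.\<close>

lemma hasse_subalgebra_generated:
  assumes "prime p" "CHAR('k::field) = p"
    and "f \<in> subalgebra_generated free_algebra (range (\<lambda>v. ncvar v ^ (p ^ e v)))"
    and "0 < r" "r < p ^ e v"
  shows "hasse v r (f :: ('n, 'k) ncpoly) = 0"
  using assms(3,4,5)
proof (induction f arbitrary: r rule: subalgebra_generated.induct)
  case (generator s)
  then show ?case using hasse_ncvar_prime_power[OF assms(1,2)] by auto
next
  case (mult x y)
  \<comment> \<open>As \<open>s\<close> and \<open>r - s\<close> add up to the positive
    \<open>r\<close>, at least one of them is a positive order, still below
    \<open>p ^ e v\<close>.\<close>
  have "hasse v s x * hasse v (r - s) y = 0" if "s \<le> r" for s
    using mult that by (cases "s = 0") auto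
  then show ?case by (simp add: hasse_mult)
qed (simp_all add: hasse_add hasse_single_mult)

section \<open>Quotients by constants of the derivations\<close>

lemma (in ring) ideal_of_closed:
  assumes "J \<subseteq> carrier R" "\<zero> \<in> J"
    and add: "\<And>x y. x \<in> J \<Longrightarrow> y \<in> J \<Longrightarrow> x \<oplus> y \<in> J"
    and l: "\<And>x a. x \<in> J \<Longrightarrow> a \<in> carrier R \<Longrightarrow> a \<otimes> x \<in> J"
    and r: "\<And>x a. x \<in> J \<Longrightarrow> a \<in> carrier R \<Longrightarrow> x \<otimes> a \<in> J"
  shows "ideal J R"
proof (rule idealI[OF ring_axioms add.subgroupI])
  show "a_inv R x \<in> J" if "x \<in> J" for x
    using l[OF that, of "\<ominus> \<one>"] that assms(1) by (auto simp: l_minus)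
qed (use assms in auto)

lemma sum_mem_additive_subgroup:
  assumes "additive_subgroup I (free_algebra :: ('k::field, ('n, 'k) ncpoly) module)"
    and "\<And>s. s \<in> T \<Longrightarrow> g s \<in> I"
  shows "sum g T \<in> I"
proof -
  interpret additive_subgroup I "free_algebra :: ('k, ('n, 'k) ncpoly) module" by fact
  show ?thesis using assms(2)
    by (induction T rule: infinite_finite_induct) (use zero_closed a_closed in auto)
qed

text \<open>By the Leibniz rule, the elements whose divided powers all lie in \<open>I\<close> form
  an ideal. It contains \<open>G\<close>, since order 0 is the identity and higher orders kill
  \<open>G\<close>; hence it contains \<open>I\<close>.\<close>

lemma hasse_Idl:
  fixes G :: "('n, 'k::field) ncpoly set"
  defines "I \<equiv> Idl\<^bsub>free_algebra\<^esub> G"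
  assumes G: "\<And>v r g. g \<in> G \<Longrightarrow> 0 < r \<Longrightarrow> r < q v \<Longrightarrow> hasse v r g = 0"
    and f: "f \<in> I" and r: "r < q v"
  shows "hasse v r f \<in> I"
proof -
  let ?F = "free_algebra :: ('k, ('n, 'k) ncpoly) module"
  interpret R: ring ?F using assoc_algebra_free_algebra unfolding assoc_algebra_def by blast
  interpret I: ideal I ?F unfolding I_def by (rule R.genideal_ideal) simp
  note [simp] = I.zero_closed[simplified]
  note I_sum = sum_mem_additive_subgroup[OF I.additive_subgroup_axioms]
  let ?J = "{x. \<forall>v r. r < q v \<longrightarrow> hasse v r x \<in> I}"
  have "ideal ?J ?F"
  proof (rule R.ideal_of_closed)
    show "x \<oplus>\<^bsub>?F\<^esub> y \<in> ?J" if "x \<in> ?J" "y \<in> ?J" for x y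
      using that I.a_closed by (auto simp: hasse_add)
    show "x \<otimes>\<^bsub>?F\<^esub> a \<in> ?J" if "x \<in> ?J" for x a
      using that I.I_r_closed by (auto simp: hasse_mult intro!: I_sum)
    show "a \<otimes>\<^bsub>?F\<^esub> x \<in> ?J" if "x \<in> ?J" for x a
      using that I.I_l_closed by (auto simp: hasse_mult intro!: I_sum)
  qed auto
  moreover have "G \<subseteq> ?J"
  proof clarify
    fix g v r assume "g \<in> G" "r < q v"
    moreover have "G \<subseteq> I" unfolding I_def by (rule R.genideal_self) simp
    ultimately show "hasse v r g \<in> I" using G[of g r v] by (cases "r = 0") auto
  qed
  ultimately have "I \<subseteq> ?J" unfolding I_def by (rule R.genideal_minimal)
  then show ?thesis using f r by auto
qed

text \<open>The presentation is forgotten here: the relations enter only through the stability of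
  \<open>I\<close> under the operators.\<close>

locale hasse_quotient =
  fixes p :: nat and e :: "'n \<Rightarrow> nat" and I :: "('n, 'k::field) ncpoly set"
  assumes prime: "prime p" and char: "CHAR('k) = p"
    and I_ideal: "ideal I (free_algebra :: ('k, ('n, 'k) ncpoly) module)"
    and hasse_I: "r < p ^ e v \<Longrightarrow> x \<in> I \<Longrightarrow> hasse v r x \<in> I"
begin

abbreviation F :: "('k, ('n, 'k) ncpoly) module" where "F \<equiv> free_algebra"
abbreviation A :: "('k, ('n, 'k) ncpoly set) module" where "A \<equiv> quotient_algebra F I"

abbreviation proj :: "('n, 'k) ncpoly \<Rightarrow> ('n, 'k) ncpoly set" where
  "proj x \<equiv> I +>\<^bsub>F\<^esub> x"

abbreviation AX :: "'n \<Rightarrow> ('n, 'k) ncpoly set \<Rightarrow> ('n, 'k) ncpoly set" where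
  "AX v \<equiv> quotient_map F I (\<lambda>f. ncvar v * f)"

abbreviation AD :: "'n \<Rightarrow> nat \<Rightarrow> ('n, 'k) ncpoly set \<Rightarrow> ('n, 'k) ncpoly set" where
  "AD v r \<equiv> quotient_map F I (hasse v r)"

interpretation I: ideal I F by (rule I_ideal)

interpretation F: weyl_action F "\<lambda>v. p ^ e v" UNIV "\<lambda>v f. ncvar v * f" hasse
  using prime char by (rule weyl_action_free_algebra)

lemma A_algebra: "assoc_algebra A"
  by (rule assoc_algebra_quotient[OF assoc_algebra_free_algebra I_ideal])

interpretation AM: Module.module class_ring A
  using A_algebra unfolding assoc_algebra_def by blast

interpretation AR: ring A
  using A_algebra unfolding assoc_algebra_def by blast

lemma submodule_ideal:
  assumes "ideal J A" shows "submodule class_ring J A"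
proof -
  interpret J: ideal J A by fact
  show ?thesis
    by (rule submodule.intro) (use ideal_smult[OF A_algebra assms] in \<open>auto intro: AM.module_axioms J.a_Hcarr\<close>)
qed

lemma I_submodule: "submodule class_ring I F"
proof (rule submodule.intro[OF F.module_axioms I.a_subset
      additive_subgroup.a_closed[OF I.additive_subgroup_axioms]
      additive_subgroup.zero_closed[OF I.additive_subgroup_axioms]])
  show "c \<odot>\<^bsub>F\<^esub> x \<in> I" if "x \<in> I" for c x
    by (rule ideal_smult[OF assoc_algebra_free_algebra I_ideal that])
qed

lemma ncvar_mult_I: "x \<in> I \<Longrightarrow> ncvar v * x \<in> I"
  using I.I_l_closed[of x "ncvar v"] by simp

lemma carrier_A: "carrier A = range proj"
  using carrier_quotient[OF F.module_axioms I_submodule] by simp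

lemma proj_add: "proj (x + y) = proj x \<oplus>\<^bsub>A\<^esub> proj y"
  using coset_add[OF F.module_axioms I_submodule, of x y] by simp

lemma proj_zero: "proj 0 = \<zero>\<^bsub>A\<^esub>"
  using coset_zero[OF F.module_axioms I_submodule] by simp

lemma proj_mult: "proj (x * y) = proj x \<otimes>\<^bsub>A\<^esub> proj y"
  using I.rcoset_mult_add[of x y] by (simp add: quotient_algebra_simps)

lemma proj_closed: "proj x \<in> carrier A"
  by (simp add: carrier_A)

lemma proj_diff: "proj (x - y) = proj x \<ominus>\<^bsub>A\<^esub> proj y"
proof -
  have "\<ominus>\<^bsub>A\<^esub> proj y = proj (- y)"
    by (rule AM.minus_equality) (simp_all add: proj_closed proj_zero flip: proj_add)
  then show ?thesis using proj_add[of x "- y"] by (simp add: a_minus_def)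
qed

lemma proj_sum_mem:
  assumes "submodule class_ring J A" "\<And>s. s \<in> T \<Longrightarrow> proj (g s) \<in> J"
  shows "proj (sum g T) \<in> J"
  using assms(2)
  by (induction T rule: infinite_finite_induct)
    (simp_all add: proj_zero proj_add submodule.zero_closed[OF assms(1)] submodule.m_closed[OF assms(1)])

lemma AX_proj: "AX v (proj x) = proj (ncvar v * x)"
  using quotient_map_coset[OF F.module_axioms I_submodule F.X_hom ncvar_mult_I] by simp

lemma AD_proj: "r < p ^ e v \<Longrightarrow> AD v r (proj x) = proj (hasse v r x)"
  using quotient_map_coset[OF F.module_axioms I_submodule F.D_hom hasse_I] by simp

lemma weyl_action_A: "weyl_action A (\<lambda>v. p ^ e v) UNIV AX AD"
  by (rule weyl_action_quotient[OF F.module_axioms I_submodule F.weyl_action_axioms])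
    (auto intro: ncvar_mult_I hasse_I)

section \<open>Stability of the lower central series and of its ideals\<close>

interpretation A: weyl_action A "\<lambda>v. p ^ e v" UNIV AX AD by (rule weyl_action_A)

definition stable :: "('n, 'k) ncpoly set set \<Rightarrow> bool" where
  "stable J \<longleftrightarrow> (\<forall>v r. r < p ^ e v \<longrightarrow> AD v r ` J \<subseteq> J)"

text \<open>For \<open>J\<close> inside \<open>carrier A\<close>, stability of \<open>J\<close>
  means that \<open>J\<close> lies in \<open>stable_part J\<close>. As the latter inherits closure
  properties from \<open>J\<close>, this can be tested on generators.\<close>

definition stable_part :: "('n, 'k) ncpoly set set \<Rightarrow> ('n, 'k) ncpoly set set" where
  "stable_part J = {y \<in> carrier A. \<forall>v r. r < p ^ e v \<longrightarrow> AD v r y \<in> J}"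

lemma submodule_stable_part:
  assumes "submodule class_ring J A" shows "submodule class_ring (stable_part J) A"
proof -
  interpret J: submodule class_ring J A by fact
  show ?thesis
  proof (rule submodule.intro[OF AM.module_axioms])
    note hom = LinearCombinations.module_hom_add[OF A.D_hom] LinearCombinations.module_hom_smult[OF A.D_hom]
    show "x \<oplus>\<^bsub>A\<^esub> y \<in> stable_part J" if "x \<in> stable_part J" "y \<in> stable_part J" for x y
      using that by (simp add: stable_part_def hom)
    show "c \<odot>\<^bsub>A\<^esub> x \<in> stable_part J" if "c \<in> carrier class_ring" "x \<in> stable_part J" for c x
      using that AM.smult_closed[of c x] J.smult_closed[of c] by (simp add: stable_part_def hom)
    show "\<zero>\<^bsub>A\<^esub> \<in> stable_part J" using J.zero_closed by (simp add: stable_part_def A.D_zero)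
  qed (auto simp: stable_part_def)
qed

text \<open>Leibniz for commutators: \<open>D_r [a, l]\<close> is the sum of the
  \<open>[D_s a, D_(r-s) l]\<close>, and \<open>D_(r-s) l\<close> stays in the previous term by
  induction.\<close>

lemma lower_central_stable: "stable (lower_central A i)"
proof (induction i rule: induct_nat_012)
  case 0
  then show ?case by (auto simp: stable_def A.D_closed)
next
  case 1
  then show ?case by (auto simp: stable_def A.D_closed)
next
  case (ge2 i)
  let ?G = "{a \<otimes>\<^bsub>A\<^esub> l \<ominus>\<^bsub>A\<^esub> l \<otimes>\<^bsub>A\<^esub> a | a l. a \<in> carrier A \<and> l \<in> lower_central A (Suc i)}"
  let ?L = "lower_central A (Suc (Suc i))"
  have sub: "lower_central A (Suc i) \<subseteq> carrier A" by (rule lower_central_subset_carrier[OF A_algebra])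
  have G: "?G \<subseteq> carrier A" using sub by (auto simp: a_minus_def)
  have L: "?L = AM.span ?G" by simp
  have Lsub: "submodule class_ring ?L A" unfolding L using G by (rule AM.span_is_submodule)
  have GL: "?G \<subseteq> ?L" unfolding L using G by (rule AM.in_own_span)
  have "?G \<subseteq> stable_part ?L"
  proof clarify
    fix a l assume a: "a \<in> carrier A" and l: "l \<in> lower_central A (Suc i)"
    obtain x where x: "a = proj x" using a by (auto simp: carrier_A)
    obtain y where y: "l = proj y" using l sub by (auto simp: carrier_A)
    have comm: "a \<otimes>\<^bsub>A\<^esub> l \<ominus>\<^bsub>A\<^esub> l \<otimes>\<^bsub>A\<^esub> a = proj (x * y - y * x)"
      by (simp add: x y proj_diff proj_mult)
    have "proj (hasse v r (x * y - y * x)) \<in> ?L" if r: "r < p ^ e v" for v r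
    proof -
      \<comment> \<open>Reversing the summation for \<open>y * x\<close> pairs equal orders with
        those for \<open>x * y\<close>, so that each difference is a commutator.\<close>
      have "(\<Sum>s\<le>r. hasse v s y * hasse v (r - s) x) = (\<Sum>s\<le>r. hasse v (r - s) y * hasse v s x)"
        by (rule sum.reindex_bij_witness[of _ "\<lambda>s. r - s" "\<lambda>s. r - s"]) auto
      then have "hasse v r (x * y - y * x) =
          (\<Sum>s\<le>r. hasse v s x * hasse v (r - s) y - hasse v (r - s) y * hasse v s x)"
        by (simp add: hasse_diff hasse_mult sum_subtractf)
      moreover have "proj (\<Sum>s\<le>r. hasse v s x * hasse v (r - s) y - hasse v (r - s) y * hasse v s x) \<in> ?L"
      proof (rule proj_sum_mem[OF Lsub])
        fix s
        have "proj (hasse v (r - s) y) = AD v (r - s) l"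
          using r by (simp add: y AD_proj)
        also have "\<dots> \<in> lower_central A (Suc i)"
          using ge2(2) l r by (auto simp: stable_def image_subset_iff)
        finally show "proj (hasse v s x * hasse v (r - s) y - hasse v (r - s) y * hasse v s x) \<in> ?L"
          using GL proj_closed[of "hasse v s x"] unfolding proj_diff proj_mult by blast
      qed
      ultimately show ?thesis by (simp only:)
    qed
    then show "a \<otimes>\<^bsub>A\<^esub> l \<ominus>\<^bsub>A\<^esub> l \<otimes>\<^bsub>A\<^esub> a \<in> stable_part ?L"
      unfolding comm by (simp add: stable_part_def AD_proj proj_closed del: lower_central.simps)
  qed
  then have "?L \<subseteq> stable_part ?L"
    unfolding L[unfolded lower_central.simps] using submodule_stable_part[OF Lsub]
    by (simp only: L AM.span_is_subset)
  then show ?case unfolding stable_def stable_part_def by blast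
qed

lemma lower_central_ideal_ideal: "ideal (lower_central_ideal A i) A"
  unfolding lower_central_ideal_def
  by (rule AR.genideal_ideal[OF lower_central_subset_carrier[OF A_algebra]])

text \<open>\<open>stable_part ?J\<close> is an ideal by the Leibniz rule and contains
  \<open>lower_central A i\<close>, so it contains the generated ideal \<open>?J\<close>.\<close>

lemma lower_central_ideal_stable: "stable (lower_central_ideal A i)"
proof -
  let ?J = "lower_central_ideal A i"
  interpret J: ideal ?J A by (rule lower_central_ideal_ideal)
  have Jsub: "submodule class_ring ?J A" by (rule submodule_ideal[OF lower_central_ideal_ideal])
  interpret S: submodule class_ring "stable_part ?J" A by (rule submodule_stable_part[OF Jsub])
  \<comment> \<open>The disjunction serves the left and the right ideal property at once: in each
    Leibniz term the factor coming from the stable part lies in \<open>?J\<close>.\<close>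
  have prod: "proj x \<otimes>\<^bsub>A\<^esub> proj y \<in> stable_part ?J"
    if xy: "proj x \<in> stable_part ?J \<or> proj y \<in> stable_part ?J" for x y
  proof -
    have "proj (hasse v r (x * y)) \<in> ?J" if r: "r < p ^ e v" for v r
      unfolding hasse_mult
    proof (rule proj_sum_mem[OF Jsub])
      fix s assume "s \<in> {..r}"
      then have s: "s < p ^ e v" "r - s < p ^ e v" using r by auto
      have "AD v s (proj x) \<in> ?J \<or> AD v (r - s) (proj y) \<in> ?J"
        using xy s unfolding stable_part_def by blast
      then have "proj (hasse v s x) \<in> ?J \<or> proj (hasse v (r - s) y) \<in> ?J"
        using s by (simp add: AD_proj)
      then show "proj (hasse v s x * hasse v (r - s) y) \<in> ?J"
        unfolding proj_mult using proj_closed J.I_l_closed J.I_r_closed by blast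
    qed
    then show ?thesis by (simp add: stable_part_def AD_proj proj_closed flip: proj_mult)
  qed
  have "ideal (stable_part ?J) A"
  proof (rule AR.ideal_of_closed)
    show "stable_part ?J \<subseteq> carrier A" by (rule S.subset)
    show "a \<otimes>\<^bsub>A\<^esub> x \<in> stable_part ?J" "x \<otimes>\<^bsub>A\<^esub> a \<in> stable_part ?J"
      if "x \<in> stable_part ?J" "a \<in> carrier A" for x a
      using that prod S.subset by (auto simp: carrier_A)
  qed (rule S.zero_closed S.m_closed; assumption?)+
  moreover have "lower_central A i \<subseteq> stable_part ?J"
  proof -
    have "lower_central A i \<subseteq> ?J" unfolding lower_central_ideal_def
      by (rule AR.genideal_self[OF lower_central_subset_carrier[OF A_algebra]])
    then show ?thesis
      using lower_central_stable[of i] lower_central_subset_carrier[OF A_algebra, of i]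
      unfolding stable_def stable_part_def by blast
  qed
  ultimately have "?J \<subseteq> stable_part ?J"
    unfolding lower_central_ideal_def[of A i] by (rule AR.genideal_minimal)
  then show ?thesis by (auto simp: stable_def stable_part_def)
qed

section \<open>The action on the successive quotients\<close>

lemma lower_central_ideal_decreasing:
  assumes "i \<ge> 1" shows "lower_central_ideal A (Suc i) \<subseteq> lower_central_ideal A i"
proof -
  obtain j where i: "i = Suc j" using assms by (cases i) auto
  let ?J = "lower_central_ideal A i"
  interpret J: ideal ?J A by (rule lower_central_ideal_ideal)
  have L: "lower_central A i \<subseteq> ?J" unfolding lower_central_ideal_def
    by (rule AR.genideal_self[OF lower_central_subset_carrier[OF A_algebra]])
  have "{a \<otimes>\<^bsub>A\<^esub> l \<ominus>\<^bsub>A\<^esub> l \<otimes>\<^bsub>A\<^esub> a | a l. a \<in> carrier A \<and> l \<in> lower_central A i} \<subseteq> ?J"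
    using L J.I_l_closed J.I_r_closed unfolding a_minus_def
    by (auto intro!: J.a_closed J.a_inv_closed)
  then have "lower_central A (Suc i) \<subseteq> ?J"
    unfolding i lower_central.simps
    using AM.span_is_subset[OF _ submodule_ideal[OF lower_central_ideal_ideal]] by simp
  then show ?thesis
    unfolding lower_central_ideal_def[of A "Suc i"] by (rule AR.genideal_minimal[OF J.ideal_axioms])
qed

lemma weyl_action_lower_central_quotient:
  assumes "i \<ge> 1"
  shows "\<exists>X D. weyl_action (lower_central_quotient A i) (\<lambda>v. p ^ e v) UNIV X D"
proof -
  let ?M = "lower_central_ideal A"
  have sub: "submodule class_ring (?M j) A" for j
    by (rule submodule_ideal[OF lower_central_ideal_ideal])
  have X: "AX v x \<in> ?M j" if x: "x \<in> ?M j" for v x j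
  proof -
    interpret J: ideal "?M j" A by (rule lower_central_ideal_ideal)
    obtain f where f: "x = proj f" using J.a_Hcarr[OF x] by (auto simp: carrier_A)
    \<comment> \<open>\<open>AX v\<close> is left multiplication by the class of \<open>x_v\<close>,
      so it preserves every ideal.\<close>
    have "AX v x = proj (ncvar v) \<otimes>\<^bsub>A\<^esub> x" by (simp add: f AX_proj proj_mult)
    then show ?thesis using J.I_l_closed[OF x proj_closed] by simp
  qed
  have D: "AD v r x \<in> ?M j" if "r < p ^ e v" "x \<in> ?M j" for v r x j
    using lower_central_ideal_stable[of j] that unfolding stable_def by blast
  let ?B = "A\<lparr>carrier := ?M i\<rparr>"
  have W: "weyl_action ?B (\<lambda>v. p ^ e v) UNIV AX AD"
    by (rule A.weyl_action_submodule[OF sub X D])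
  interpret B: weyl_action ?B "\<lambda>v. p ^ e v" UNIV AX AD by (rule W)
  \<comment> \<open>The action is first restricted to the ideal \<open>?M i\<close> and then passed
    to its quotient by \<open>?M (Suc i)\<close>.\<close>
  have "submodule class_ring (?M (Suc i)) ?B"
    using sub[of "Suc i"] lower_central_ideal_decreasing[OF assms] B.module_axioms
    by (auto simp: submodule_def)
  then show ?thesis
    unfolding lower_central_quotient_def
    using weyl_action_quotient[OF B.module_axioms _ W X D] by blast
qed

end

theorem corollary2p12:
  fixes p m i :: nat
    and e :: "'n::finite \<Rightarrow> nat"
    and f :: "nat \<Rightarrow> ('n, 'k::alg_closed_field) ncpoly"
    and A :: "('k, ('n, 'k) ncpoly set) module"
  assumes "prime p" and "p > 2" and "CHAR('k) = p"
    and "\<And>j. j \<in> {1..m} \<Longrightarrow>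
      f j \<in> subalgebra_generated free_algebra (range (\<lambda>v. ncvar v ^ (p ^ e v)))"
    and "A = quotient_algebra free_algebra (Idl\<^bsub>free_algebra\<^esub> (f ` {1..m}))"
    and "i \<ge> 1"
    and "vectorspace.fin_dim class_ring (lower_central_quotient A i)"
  shows "p ^ (\<Sum>v\<in>UNIV. e v) dvd vectorspace.dim class_ring (lower_central_quotient A i)"
proof -
  let ?F = "free_algebra :: ('k, ('n, 'k) ncpoly) module"
  let ?I = "Idl\<^bsub>?F\<^esub> (f ` {1..m})"
  interpret F: ring ?F using assoc_algebra_free_algebra unfolding assoc_algebra_def by blast
  interpret hasse_quotient p e ?I
  proof (rule hasse_quotient.intro)
    show "ideal ?I ?F" by (rule F.genideal_ideal) simp
    \<comment> \<open>Each \<open>f j\<close> is killed by the operators of positive order below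
      \<open>p ^ e v\<close>, so \<open>hasse_Idl\<close> applies to the ideal of relations.\<close>
    show "hasse v r x \<in> ?I" if "r < p ^ e v" "x \<in> ?I" for v r x
      using hasse_subalgebra_generated[OF assms(1,3,4)] that by (intro hasse_Idl) auto
  qed (use assms in simp_all)
  obtain X D where "weyl_action (lower_central_quotient A i) (\<lambda>v. p ^ e v) UNIV X D"
    using weyl_action_lower_central_quotient[OF assms(6)] assms(5) by auto
  then have "(\<Prod>v\<in>UNIV. p ^ e v) dvd vectorspace.dim class_ring (lower_central_quotient A i)"
    using assms(7) prime_gt_0_nat[OF assms(1)] by (intro weyl_action_dvd_dim) auto
  then show ?thesis by (simp add: power_sum)
qed

end
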